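(* Let $(X,\triangleright)$ be a quasi rack and assume that, for all $x,y\in X$, $$L_y(x)=L_{L^0_x(y)}(x).$$ Then the derived map $r_\triangleright:X\times X\to X\times X$, $r_\triangleright(x,y)=\left(L^0_x(y),\,L_y(x)\right)$, associated to $(X,\triangleright)$ is a quasi non-degenerate solution.
   Context: Juxtaposition of maps denotes composition, $(fg)(x)=f(g(x))$. For a map $f:X\to X$, a relative inverse of $f$ is a map $f^-:X\to X$ with $ff^-f=f$, $f^-ff^-=f^-$, $ff^-=f^-f$; it is unique if it exists, and $f^0:=ff^-=f^-f$. A (left) shelf $(X,\triangleright)$ is a set $X$ with a binary operation such that $x\triangleright(y\triangleright z)=(x\triangleright y)\triangleright(x\triangleright z)$ for all $x,y,z$; write $L_x(y)=x\triangleright y$. A quasi rack is a shelf such that every $L_x$ has a relative inverse $L_x^-$ and $L_x^0L_y=L_yL_x^0$ for all $x,y\in X$, where $L^0_x=L_xL_x^-=L_x^-L_x$. A solution is a pair $(X,r)$ with $r:X\times X\to X\times X$ satisfying $(r\times\mathrm{id}_X)(\mathrm{id}_X\times r)(r\times\mathrm{id}_X)=(\mathrm{id}_X\times r)(r\times\mathrm{id}_X)(\mathrm{id}_X\times r)$; write $r(x,y)=(\lambda_x(y),\rho_y(x))$. It is quasi left non-degenerate if every $\lambda_x$ has a relative inverse $\lambda_x^-$ and $\lambda_x^0\lambda_y=\lambda_y\lambda_x^0$ for all $x,y$; quasi right non-degenerate if every $\rho_x$ has a relative inverse $\rho_x^-$ and $\rho_x^0\rho_y=\rho_y\rho_x^0$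 for all $x,y$; quasi non-degenerate if both. *)

theory Defs
  imports Main
begin

text \<open>
  The underlying set \<open>X\<close> is the type \<^typ>\<open>'a\<close>, so maps \<open>X \<rightarrow> X\<close> are the
  functions \<open>'a \<Rightarrow> 'a\<close>. For a binary operation \<open>op\<close>, the left multiplication \<open>L\<^sub>x\<close> is the
  partial application \<open>op x\<close>.
\<close>

definition is_rel_inverse :: "('a \<Rightarrow> 'a) \<Rightarrow> ('a \<Rightarrow> 'a) \<Rightarrow> bool" where
  "is_rel_inverse f g \<longleftrightarrow> f \<circ> g \<circ> f = f \<and> g \<circ> f \<circ> g = g \<and> f \<circ> g = g \<circ> f"

definition has_rel_inverse :: "('a \<Rightarrow> 'a) \<Rightarrow> bool" where
  "has_rel_inverse f \<longleftrightarrow> (\<exists>g. is_rel_inverse f g)"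

lemma is_rel_inverse_unique:
  assumes f: "is_rel_inverse f g" and h: "is_rel_inverse f h"
  shows "g = h"
proof -
  have fg: "f (g (f x)) = f x" "g (f (g x)) = g x" "f (g x) = g (f x)" for x
    using f unfolding is_rel_inverse_def by (metis comp_apply)+
  have fh: "f (h (f x)) = f x" "h (f (h x)) = h x" "f (h x) = h (f x)" for x
    using h unfolding is_rel_inverse_def by (metis comp_apply)+
  have eq: "g (f x) = h (f x)" for x
    by (metis fg(1,3) fh(1,3))
  show ?thesis
    by (rule ext) (metis eq fg(2,3) fh(2,3))
qed

text \<open>
  The maps written \<open>f\<^sup>-\<close> and \<open>f\<^sup>0 = f f\<^sup>-\<close>; both are meaningful only when
  \<^term>\<open>has_rel_inverse f\<close> holds.
\<close>

definition rel_inverse :: "('a \<Rightarrow> 'a) \<Rightarrow> ('a \<Rightarrow> 'a)" where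
  "rel_inverse f = (THE g. is_rel_inverse f g)"

definition rel_idem :: "('a \<Rightarrow> 'a) \<Rightarrow> ('a \<Rightarrow> 'a)" where
  "rel_idem f = f \<circ> rel_inverse f"

lemma is_rel_inverse_rel_inverse:
  assumes "has_rel_inverse f"
  shows "is_rel_inverse f (rel_inverse f)"
  using assms unfolding has_rel_inverse_def rel_inverse_def
  by (metis is_rel_inverse_unique theI)

definition shelf :: "('a \<Rightarrow> 'a \<Rightarrow> 'a) \<Rightarrow> bool" where
  "shelf op \<longleftrightarrow> (\<forall>x y z. op x (op y z) = op (op x y) (op x z))"

definition quasi_rack :: "('a \<Rightarrow> 'a \<Rightarrow> 'a) \<Rightarrow> bool" where
  "quasi_rack op \<longleftrightarrow> shelf op \<and> (\<forall>x. has_rel_inverse (op x)) \<and>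
     (\<forall>x y. rel_idem (op x) \<circ> op y = op y \<circ> rel_idem (op x))"

text \<open>
  \<open>X \<times> X \<times> X\<close> is \<^typ>\<open>'a \<times> 'a \<times> 'a\<close>, which nests to the right; hence \<open>r \<times> id\<close> has to
  rebracket, while \<open>id \<times> r\<close> is literally \<^term>\<open>map_prod id r\<close>.
\<close>

definition prod_id :: "('a \<times> 'a \<Rightarrow> 'a \<times> 'a) \<Rightarrow> 'a \<times> 'a \<times> 'a \<Rightarrow> 'a \<times> 'a \<times> 'a" where
  "prod_id r = (\<lambda>(x, y, z). (fst (r (x, y)), snd (r (x, y)), z))"

definition id_prod :: "('a \<times> 'a \<Rightarrow> 'a \<times> 'a) \<Rightarrow> 'a \<times> 'a \<times> 'a \<Rightarrow> 'a \<times> 'a \<times> 'a" where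
  "id_prod r = map_prod id r"

definition solution :: "('a \<times> 'a \<Rightarrow> 'a \<times> 'a) \<Rightarrow> bool" where
  "solution r \<longleftrightarrow> prod_id r \<circ> id_prod r \<circ> prod_id r = id_prod r \<circ> prod_id r \<circ> id_prod r"

text \<open>
  The components in \<open>r (x, y) = (\<lambda>\<^sub>x(y), \<rho>\<^sub>y(x))\<close>; the first argument of each is the
  subscript.
\<close>

definition lam :: "('a \<times> 'a \<Rightarrow> 'a \<times> 'a) \<Rightarrow> 'a \<Rightarrow> 'a \<Rightarrow> 'a" where
  "lam r x y = fst (r (x, y))"

definition rho :: "('a \<times> 'a \<Rightarrow> 'a \<times> 'a) \<Rightarrow> 'a \<Rightarrow> 'a \<Rightarrow> 'a" where
  "rho r y x = snd (r (x, y))"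

definition quasi_left_nondegenerate :: "('a \<times> 'a \<Rightarrow> 'a \<times> 'a) \<Rightarrow> bool" where
  "quasi_left_nondegenerate r \<longleftrightarrow> (\<forall>x. has_rel_inverse (lam r x)) \<and>
     (\<forall>x y. rel_idem (lam r x) \<circ> lam r y = lam r y \<circ> rel_idem (lam r x))"

definition quasi_right_nondegenerate :: "('a \<times> 'a \<Rightarrow> 'a \<times> 'a) \<Rightarrow> bool" where
  "quasi_right_nondegenerate r \<longleftrightarrow> (\<forall>x. has_rel_inverse (rho r x)) \<and>
     (\<forall>x y. rel_idem (rho r x) \<circ> rho r y = rho r y \<circ> rel_idem (rho r x))"

definition quasi_nondegenerate :: "('a \<times> 'a \<Rightarrow> 'a \<times> 'a) \<Rightarrow> bool" where
  "quasi_nondegenerate r \<longleftrightarrow> quasi_left_nondegenerate r \<and> quasi_right_nondegenerate r"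

definition derived_map :: "('a \<Rightarrow> 'a \<Rightarrow> 'a) \<Rightarrow> 'a \<times> 'a \<Rightarrow> 'a \<times> 'a" where
  "derived_map op = (\<lambda>(x, y). (rel_idem (op x) y, op y x))"

end

theory Submission
  imports Defs
begin

text \<open>
  Write \<open>e\<^sub>x\<close> for the idempotent \<open>L\<^sub>x\<^sup>0\<close>, so that \<open>r(x, y) = (e\<^sub>x y, L\<^sub>y x)\<close>.
  In a quasi rack every \<open>e\<^sub>x\<close> commutes with every \<open>L\<^sub>y\<close>, hence also with every \<open>L\<^sub>y\<^sup>-\<close> and with
  every \<open>e\<^sub>y\<close>. This gives non-degeneracy at once: \<open>\<lambda>\<^sub>x = e\<^sub>x\<close> is its own relative inverse and
  these idempotents commute, while \<open>\<rho>\<^sub>y = L\<^sub>y\<close> satisfies the condition by the quasi rack axioms.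

  Comparing the three components of the two sides of the braid equation at \<open>(x, y, z)\<close> leaves
  \<open>e\<^bsub>e\<^sub>x y\<^esub> e\<^bsub>L\<^sub>y x\<^esub> z = e\<^sub>x e\<^sub>y z\<close>,
  \<open>L\<^bsub>u\<^esub> e\<^sub>x y = e\<^bsub>v\<^esub> L\<^sub>z y\<close> with \<open>u = e\<^bsub>L\<^sub>y x\<^esub> z\<close> and \<open>v = L\<^bsub>e\<^sub>y z\<^esub> x\<close>, and
  \<open>L\<^sub>z L\<^sub>y x = L\<^bsub>L\<^sub>z y\<^esub> L\<^bsub>e\<^sub>y z\<^esub> x\<close>.
  They rest on two consequences of self-distributivity: after applying \<open>e\<^sub>x\<close>, the
  subscripts \<open>y\<close> and \<open>e\<^sub>x y\<close> of \<open>L\<close> and of \<open>e\<close> can no longer be told apart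
  (\<open>e_left_mult_e\<close>, \<open>e_e_subscript\<close>), and \<open>e\<^bsub>L\<^sub>y x\<^esub> e\<^sub>y = e\<^sub>x e\<^sub>y\<close> (\<open>e_conjugate\<close>), because
  \<open>L\<^bsub>L\<^sub>y x\<^esub>\<close> cut down by \<open>e\<^sub>y\<close> is \<open>L\<^sub>y L\<^sub>x L\<^sub>y\<^sup>-\<close>. The extra hypothesis
  \<open>L\<^sub>y x = L\<^bsub>e\<^sub>x y\<^esub> x\<close> supplies the missing idempotents, by permitting the replacement of \<open>y\<close>
  by \<open>e\<^sub>x y\<close> as a subscript acting on \<open>x\<close>.
\<close>

lemma rel_idem_eq_comp:
  assumes "is_rel_inverse f g"
  shows "rel_idem f = f \<circ> g"
proof -
  have "is_rel_inverse f (rel_inverse f)"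
    using assms has_rel_inverse_def is_rel_inverse_rel_inverse by blast
  with assms have "rel_inverse f = g"
    by (rule is_rel_inverse_unique[rotated])
  then show ?thesis
    by (simp add: rel_idem_def)
qed

lemma idempotent_is_rel_inverse_self:
  assumes "f \<circ> f = f"
  shows "is_rel_inverse f f"
  using assms by (simp add: is_rel_inverse_def)

text \<open>
  Inserting \<open>f\<^sup>- = f f\<^sup>- f\<^sup>- = f\<^sup>- f\<^sup>- f\<close> and moving \<open>f\<close> past \<open>h\<close> brings both \<open>h f\<^sup>-\<close> and \<open>f\<^sup>- h\<close>
  to the form \<open>f\<^sup>- h f f\<^sup>-\<close>.
\<close>

lemma is_rel_inverse_commute:
  assumes g: "is_rel_inverse f g" and h: "\<And>x. h (f x) = f (h x)"
  shows "h (g x) = g (h x)"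
proof -
  have fg: "f (g (f x)) = f x" "g (f (g x)) = g x" "f (g x) = g (f x)" for x
    using g unfolding is_rel_inverse_def by (metis comp_apply)+
  have "h (g x) = h (f (g (g x)))"
    by (metis fg(2,3))
  also have "\<dots> = f (g (f (h (g (g x)))))"
    by (metis h fg(1))
  also have "\<dots> = g (f (h (f (g (g x)))))"
    by (metis h fg(3))
  also have "\<dots> = g (h (f (g x)))"
    by (metis h fg)
  finally have left: "h (g x) = g (h (f (g x)))" .
  have "g (h x) = g (g (f (h x)))"
    by (metis fg(2,3))
  also have "\<dots> = g (g (h (f (g (f x)))))"
    by (metis h fg(1))
  also have "\<dots> = g (g (f (h (f (g x)))))"
    by (metis h fg(3))
  also have "\<dots> = g (h (f (g x)))"
    by (metis h fg)
  finally show ?thesis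
    using left by simp
qed

locale quasi_rack_structure =
  fixes L :: "'a \<Rightarrow> 'a \<Rightarrow> 'a"
  assumes quasi_rack: "quasi_rack L"
begin

abbreviation L_inv :: "'a \<Rightarrow> 'a \<Rightarrow> 'a" where
  "L_inv x \<equiv> rel_inverse (L x)"

abbreviation e :: "'a \<Rightarrow> 'a \<Rightarrow> 'a" where
  "e x \<equiv> rel_idem (L x)"

lemma distrib: "L x (L y z) = L (L x y) (L x z)"
  using quasi_rack by (simp add: quasi_rack_def shelf_def)

lemma L_inv_is_rel_inverse: "is_rel_inverse (L x) (L_inv x)"
  using quasi_rack by (simp add: quasi_rack_def is_rel_inverse_rel_inverse)

lemma L_L_inv: "L x (L_inv x y) = e x y"
  by (simp add: rel_idem_def)

lemma L_inv_L: "L_inv x (L x y) = e x y"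
  using L_inv_is_rel_inverse unfolding is_rel_inverse_def rel_idem_def by (metis comp_apply)

lemma e_L_same: "e x (L x y) = L x y"
  using L_inv_is_rel_inverse unfolding is_rel_inverse_def rel_idem_def by (metis comp_apply)

lemma e_L_commute: "e x (L y z) = L y (e x z)"
  using quasi_rack unfolding quasi_rack_def by (metis comp_apply)

lemma e_L_inv_commute: "e x (L_inv y z) = L_inv y (e x z)"
  using L_inv_is_rel_inverse e_L_commute by (rule is_rel_inverse_commute)

lemma e_e_commute: "e x (e y z) = e y (e x z)"
  by (metis L_L_inv e_L_commute e_L_inv_commute)

lemma e_idem: "e x (e x y) = e x y"
  by (metis L_L_inv e_L_same)

text \<open>
  Self-distributivity gives
  \<open>L\<^sub>x L\<^bsub>e\<^sub>x y\<^esub> = L\<^bsub>L\<^sub>x e\<^sub>x y\<^esub> L\<^sub>x = L\<^bsub>L\<^sub>x y\<^esub> L\<^sub>x = L\<^sub>x L\<^sub>y\<close>; cancel \<open>L\<^sub>x\<close> up to \<open>e\<^sub>x\<close>.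
\<close>

lemma e_left_mult_e: "e x (L (e x y) z) = e x (L y z)"
proof -
  have "L x (L (e x y) z) = L x (L y z)"
    by (metis distrib e_L_commute e_L_same)
  then show ?thesis
    by (metis L_inv_L)
qed

text \<open>
  The maps \<open>L\<^bsub>L\<^sub>y x\<^esub> e\<^sub>y\<close> and \<open>L\<^sub>y L\<^sub>x L\<^sub>y\<^sup>-\<close> coincide. Their idempotents are
  \<open>e\<^bsub>L\<^sub>y x\<^esub> e\<^sub>y\<close> and \<open>e\<^sub>x e\<^sub>y\<close>, shown equal here by letting each absorb the other.
\<close>

lemma e_conjugate: "e (L y x) (e y z) = e x (e y z)"
proof -
  let ?a = "L y x"
  have conj: "L ?a (e y w) = L y (L x (L_inv y w))" for w
    by (metis L_L_inv distrib)
  have "e x (L ?a (e y z)) = L ?a (e y z)"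
    by (simp add: conj e_L_commute[of x y] e_L_same)
  then have absorb_x: "e x (e ?a (e y z)) = e ?a (e y z)"
    by (metis L_inv_L e_L_inv_commute)
  have "e y (e x z) = L y (L x (L_inv x (L_inv y z)))"
    by (simp only: L_L_inv) (metis L_L_inv e_L_commute e_e_commute)
  also have "\<dots> = L ?a (L y (L_inv x (L_inv y z)))"
    by (rule distrib)
  finally have absorb_a: "e ?a (e y (e x z)) = e y (e x z)"
    by (metis e_L_same)
  show ?thesis
    by (metis absorb_x absorb_a e_e_commute)
qed

text \<open>The idempotent counterpart of \<open>e_left_mult_e\<close>, by applying \<open>e_conjugate\<close> twice, since
  \<open>L\<^sub>x e\<^sub>x y = L\<^sub>x y\<close>.\<close>

lemma e_e_subscript: "e (e x y) (e x z) = e y (e x z)"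
proof -
  have "L x (e x y) = L x y"
    by (metis e_L_commute e_L_same)
  then show ?thesis
    by (metis e_conjugate)
qed

lemma quasi_left_nondegenerate_derived_map: "quasi_left_nondegenerate (derived_map L)"
proof -
  have lam: "lam (derived_map L) x = e x" for x
    by (simp add: lam_def derived_map_def fun_eq_iff)
  have inv: "is_rel_inverse (e x) (e x)" for x
    by (rule idempotent_is_rel_inverse_self) (simp add: fun_eq_iff e_idem)
  have idem: "rel_idem (e x) = e x" for x
    by (simp add: rel_idem_eq_comp[OF inv] fun_eq_iff e_idem)
  have "has_rel_inverse (e x)" for x
    using inv has_rel_inverse_def by blast
  then show ?thesis
    by (simp add: quasi_left_nondegenerate_def lam idem fun_eq_iff e_e_commute)
qed

lemma quasi_right_nondegenerate_derived_map: "quasi_right_nondegenerate (derived_map L)"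
proof -
  have "rho (derived_map L) y = L y" for y
    by (simp add: rho_def derived_map_def fun_eq_iff)
  then show ?thesis
    using quasi_rack by (simp add: quasi_right_nondegenerate_def quasi_rack_def)
qed

end

locale quasi_rack_with_exchange = quasi_rack_structure +
  assumes exchange: "L y x = L (e x y) x"
begin

text \<open>
  Reading \<open>L\<^sub>y x\<close> as \<open>L\<^bsub>e\<^sub>x y\<^esub> x\<close> makes \<open>e_conjugate\<close> applicable with conjugator \<open>e\<^sub>x y\<close>.
\<close>

lemma braid_first: "e (e x y) (e (L y x) z) = e x (e y z)"
proof -
  have "e (L y x) (e (e x y) z) = e x (e (e x y) z)"
    by (metis exchange e_conjugate)
  also have "\<dots> = e x (e y z)"
    by (metis e_e_commute e_e_subscript)
  finally show ?thesis
    by (simp add: e_e_commute)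
qed

text \<open>
  Both sides equal \<open>e\<^sub>x L\<^sub>z y\<close>. On the left the hypothesis places \<open>e\<^sub>y\<close> next to \<open>e\<^bsub>L\<^sub>y x\<^esub>\<close>, so that
  \<open>e_conjugate\<close> turns the latter into \<open>e\<^sub>x\<close>; on the right it rewrites \<open>L\<^sub>z y\<close> to \<open>L\<^bsub>w\<^esub> y\<close> with
  \<open>w = e\<^sub>y z\<close>, the conjugator already present in \<open>e\<^bsub>L\<^sub>w x\<^esub>\<close>.
\<close>

lemma braid_second: "L (e (L y x) z) (e x y) = e (L (e y z) x) (L z y)"
proof -
  have "L (e (L y x) z) (e x y) = e x (L (e (L y x) z) y)"
    by (simp add: e_L_commute)
  also have "\<dots> = e x (L (e y (e (L y x) z)) y)"
    by (metis exchange)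
  also have "\<dots> = e x (L (e y (e x z)) y)"
    by (metis e_conjugate e_e_commute)
  also have "\<dots> = e x (L (e x z) y)"
    by (metis exchange)
  also have "\<dots> = e x (L z y)"
    by (rule e_left_mult_e)
  finally have left: "L (e (L y x) z) (e x y) = e x (L z y)" .
  let ?w = "e y z"
  have w: "L z y = L ?w y"
    by (rule exchange)
  have "e (L ?w x) (L ?w y) = e (L ?w x) (e ?w (L ?w y))"
    by (simp add: e_L_same)
  also have "\<dots> = e x (e ?w (L ?w y))"
    by (rule e_conjugate)
  also have "\<dots> = e x (L ?w y)"
    by (simp add: e_L_same)
  finally show ?thesis
    using left w by simp
qed

text \<open>
  The hypothesis turns the right-hand side into an instance of self-distributivity,
  \<open>L\<^bsub>e\<^sub>y z\<^esub> L\<^sub>y x\<close>; as \<open>L\<^sub>y x\<close> is fixed by \<open>e\<^sub>y\<close>, the subscript \<open>e\<^sub>y z\<close> may be replaced by \<open>z\<close>.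
\<close>

lemma braid_third: "L z (L y x) = L (L z y) (L (e y z) x)"
proof -
  have "L (L z y) (L (e y z) x) = L (L (e y z) y) (L (e y z) x)"
    by (subst exchange[of z y]) (rule refl)
  also have "\<dots> = L (e y z) (L y x)"
    by (rule distrib[symmetric])
  also have "\<dots> = e y (L (e y z) (L y x))"
    by (simp add: e_L_commute[of y "e y z"] e_L_same)
  also have "\<dots> = e y (L z (L y x))"
    by (rule e_left_mult_e)
  also have "\<dots> = L z (L y x)"
    by (simp add: e_L_commute[of y z] e_L_same)
  finally show ?thesis
    by simp
qed

lemma solution_derived_map: "solution (derived_map L)"
proof -
  have "(prod_id (derived_map L) \<circ> id_prod (derived_map L) \<circ> prod_id (derived_map L)) (x, y, z)
      = (id_prod (derived_map L) \<circ> prod_id (derived_map L) \<circ> id_prod (derived_map L)) (x, y, z)"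
    for x y z
    unfolding o_apply prod_id_def id_prod_def derived_map_def
    using braid_first braid_second braid_third by simp
  then show ?thesis
    unfolding solution_def by (simp only: fun_eq_iff split_paired_all) simp
qed

end

theorem theorem2p16:
  fixes op :: "'a \<Rightarrow> 'a \<Rightarrow> 'a"
  assumes "quasi_rack op"
    and "\<And>x y. op y x = op (rel_idem (op x) y) x"
  shows "solution (derived_map op) \<and> quasi_nondegenerate (derived_map op)"
proof -
  interpret quasi_rack_with_exchange op
    by unfold_locales (fact assms)+
  show ?thesis
    by (simp add: solution_derived_map quasi_nondegenerate_def
        quasi_left_nondegenerate_derived_map quasi_right_nondegenerate_derived_map)
qed

end
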